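(* Let $(\Gamma,w,* )$ be a connected tracial fair and balanced $\delta$-graph with induced vertex weighting $w_V$. Then $T_0(\Gamma)=W^{\times}(\Gamma)$, where $$W^{\times}(\Gamma)=\{\lambda_\alpha=w_V(\alpha( * )) : \alpha\in\mathrm{Aut}((\Gamma,w))\}.$$
   Context: **Fair and balanced $\delta$-graphs.** A fair and balanced $\delta$-graph is a locally finite directed graph $\Gamma$ (multiple edges and self-loops allowed) with edge weights $w:E(\Gamma)\to\mathbb{R}_{>0}$ and a distinguished vertex $*$, such that (i) there is an involution $e\mapsto\overline e$ of $E(\Gamma)$ with $s(\overline e)=t(e)$, $t(\overline e)=s(e)$ and $w(e)w(\overline e)=1$; (ii) $\sum_{s(e)=x}w(e)=\delta$ for every vertex $x$. Here $s,t$ denote source and target. All such graphs are taken to be connected. A path is a sequence of edges $e_1,\dots,e_k$ (not necessarily distinct, possibly empty) with $s(e_i)=t(e_{i-1})$; its weight is $w(e_1)\cdots w(e_k)$. A loop based at $v$ is a path from $v$ to $v$. Put $T(\Gamma)=\{w(\ell):\ell\text{ a loop based at }*\}\subseteq\mathbb{R}_{>0}$. $\Gamma$ is tracial if $T(\Gamma)=\{1\}$. For tracial $\Gamma$, the vertex weighting $w_V(v)$ is the weight of any path from $*$ to $v$ (well defined); it satisfies $w(e)=w_V(t(e))/w_V(s(e))$. **Tracial cover.** For a fair and balanced $\delta$-graph $(\Lambda,w,* )$, the tracial cover $\Lambda_{tr}$ has as vertices the pairs $[\lambda,v]$ with $v\in V(\Lambda)$ and $\lambda$ the weight of some path from $*$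 to $v$; the edges from $[\lambda,v]$ to $[\lambda',v']$ correspond to the edges $e$ of $\Lambda$ with $s(e)=v$, $t(e)=v'$, $w(e)=\lambda'/\lambda$, and carry weight $w(e)$. The distinguished vertex is $[1,*]$. **The two sets.** For tracial $\Gamma$, $T_0(\Gamma)$ is the set of $\lambda\in\mathbb{R}_{>0}$ such that $\lambda\in T(\Lambda)$ for some fair and balanced $\delta$-graph $\Lambda$ with $\Lambda_{tr}\cong\Gamma$ (isomorphism of directed graphs preserving edge weights and distinguished vertices). $\mathrm{Aut}((\Gamma,w))$ is the group of automorphisms of the directed graph $\Gamma$ preserving the edge weighting (they need not fix $*$). *)

theory Defs
  imports
    Complex_Main
    "HOL-Library.Infinite_Typeclass"
    "Graph_Theory.Graph_Theory"
begin

record ('v, 'e) wgraph =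
  dgraph :: "('v, 'e) pre_digraph"
  weight :: "'e \<Rightarrow> real"
  base :: 'v

(* The involution is only required to exist: it is not part of the structure, need not be preserved
   by isomorphisms, and may fix edges (necessarily self-loops of weight 1). *)
definition fair_balanced :: "real \<Rightarrow> ('v, 'e) wgraph \<Rightarrow> bool" where
  "fair_balanced \<delta> \<Gamma> \<longleftrightarrow>
     wf_digraph (dgraph \<Gamma>) \<and>
     base \<Gamma> \<in> verts (dgraph \<Gamma>) \<and>
     connected (dgraph \<Gamma>) \<and>
     (\<forall>x \<in> verts (dgraph \<Gamma>). finite (out_arcs (dgraph \<Gamma>) x) \<and> finite (in_arcs (dgraph \<Gamma>) x)) \<and>
     (\<forall>e \<in> arcs (dgraph \<Gamma>). weight \<Gamma> e > 0) \<and>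
     (\<exists>rev. \<forall>e \<in> arcs (dgraph \<Gamma>).
        rev e \<in> arcs (dgraph \<Gamma>) \<and> rev (rev e) = e \<and>
        tail (dgraph \<Gamma>) (rev e) = head (dgraph \<Gamma>) e \<and>
        head (dgraph \<Gamma>) (rev e) = tail (dgraph \<Gamma>) e \<and>
        weight \<Gamma> e * weight \<Gamma> (rev e) = 1) \<and>
     (\<forall>x \<in> verts (dgraph \<Gamma>). (\<Sum>e \<in> out_arcs (dgraph \<Gamma>) x. weight \<Gamma> e) = \<delta>)"

definition path_weight :: "('v, 'e) wgraph \<Rightarrow> 'e list \<Rightarrow> real" where
  "path_weight \<Gamma> p = prod_list (map (weight \<Gamma>) p)"

definition loop_weights :: "('v, 'e) wgraph \<Rightarrow> real set" where
  "loop_weights \<Gamma> =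
     {path_weight \<Gamma> p | p. pre_digraph.awalk (dgraph \<Gamma>) (base \<Gamma>) p (base \<Gamma>)}"

definition tracial :: "('v, 'e) wgraph \<Rightarrow> bool" where
  "tracial \<Gamma> \<longleftrightarrow> loop_weights \<Gamma> = {1}"

(* Meaningful for tracial graphs, where all paths from the base to v have the same weight. *)
definition vertex_weight :: "('v, 'e) wgraph \<Rightarrow> 'v \<Rightarrow> real" where
  "vertex_weight \<Gamma> v =
     (THE r. \<exists>p. pre_digraph.awalk (dgraph \<Gamma>) (base \<Gamma>) p v \<and> r = path_weight \<Gamma> p)"

definition cover_verts :: "('v, 'e) wgraph \<Rightarrow> (real \<times> 'v) set" where
  "cover_verts \<Lambda> =
     {(path_weight \<Lambda> p, v) | p v.
        v \<in> verts (dgraph \<Lambda>) \<and> pre_digraph.awalk (dgraph \<Lambda>) (base \<Lambda>) p v}"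

(* An edge of the cover is an edge e of the base graph together with its two end points in the
   cover, as the triple (source, e, target). *)
definition tracial_cover ::
  "('v, 'e) wgraph \<Rightarrow> (real \<times> 'v, (real \<times> 'v) \<times> 'e \<times> (real \<times> 'v)) wgraph" where
  "tracial_cover \<Lambda> =
     \<lparr> dgraph =
         \<lparr> verts = cover_verts \<Lambda>,
           arcs = {((l, v), e, (l', v')) | l v e l' v'.
                     (l, v) \<in> cover_verts \<Lambda> \<and> (l', v') \<in> cover_verts \<Lambda> \<and>
                     e \<in> arcs (dgraph \<Lambda>) \<and>
                     tail (dgraph \<Lambda>) e = v \<and> head (dgraph \<Lambda>) e = v' \<and>
                     weight \<Lambda> e = l' / l},
           tail = (\<lambda>(x, e, y). x),
           head = (\<lambda>(x, e, y). y) \<rparr>,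
       weight = (\<lambda>(x, e, y). weight \<Lambda> e),
       base = (1, base \<Lambda>) \<rparr>"

(* The equation with app_iso f imposes nothing on tail and head outside the arcs, since iso_tail f
   and iso_head f are only constrained on images of arcs. *)
definition weighted_isomorphism ::
  "('a, 'b) wgraph \<Rightarrow> ('c, 'd) wgraph \<Rightarrow> ('a, 'b, 'c, 'd) digraph_isomorphism \<Rightarrow> bool" where
  "weighted_isomorphism \<Lambda> \<Gamma> f \<longleftrightarrow>
     pre_digraph.digraph_isomorphism (dgraph \<Lambda>) f \<and>
     dgraph \<Gamma> = app_iso f (dgraph \<Lambda>) \<and>
     (\<forall>e \<in> arcs (dgraph \<Lambda>). weight \<Gamma> (iso_arcs f e) = weight \<Lambda> e)"

definition pointed_isomorphic :: "('a, 'b) wgraph \<Rightarrow> ('c, 'd) wgraph \<Rightarrow> bool" where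
  "pointed_isomorphic \<Lambda> \<Gamma> \<longleftrightarrow>
     (\<exists>f. weighted_isomorphism \<Lambda> \<Gamma> f \<and> iso_verts f (base \<Lambda>) = base \<Gamma>)"

definition Aut :: "('v, 'e) wgraph \<Rightarrow> ('v, 'e, 'v, 'e) digraph_isomorphism set" where
  "Aut \<Gamma> = {\<alpha>. weighted_isomorphism \<Gamma> \<Gamma> \<alpha>}"

(* HOL cannot quantify over types inside a set comprehension, so the types 'a and 'b from which the
   graphs \<Lambda> draw their vertices and edges are parameters. Connected locally finite graphs are
   countable, so any infinite types contain a copy of every such graph. *)
definition T0 :: "'a itself \<Rightarrow> 'b itself \<Rightarrow> real \<Rightarrow> ('v, 'e) wgraph \<Rightarrow> real set" where
  "T0 _ _ \<delta> \<Gamma> =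
     {r. r > 0 \<and>
         (\<exists>\<Lambda> :: ('a, 'b) wgraph.
            fair_balanced \<delta> \<Lambda> \<and> pointed_isomorphic (tracial_cover \<Lambda>) \<Gamma> \<and> r \<in> loop_weights \<Lambda>)}"

definition W_times :: "('v, 'e) wgraph \<Rightarrow> real set" where
  "W_times \<Gamma> = {vertex_weight \<Gamma> (iso_verts \<alpha> (base \<Gamma>)) | \<alpha>. \<alpha> \<in> Aut \<Gamma>}"

end

(* A loop of weight r in \<Lambda> makes (l, v) \<mapsto> (r l, v) an automorphism of the tracial cover, and it moves the
   base vertex to a vertex of weight r; conjugating by the isomorphism with \<Gamma> gives one inclusion.
   Conversely, let \<alpha> be an automorphism with \<lambda> = w_V(\<alpha>( * )). Since w_V o \<alpha> = \<lambda> w_V, for \<lambda> \<noteq> 1 a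
   vertex is determined by its weight and its orbit under the powers of \<alpha>, so the quotient of \<Gamma> by
   these powers has tracial cover \<Gamma>, and a path from * to \<alpha>( * ) becomes a loop of weight \<lambda>.
   For \<lambda> = 1 take \<Gamma> itself. *)

theory Submission
  imports Defs "HOL-Library.Countable_Set"
begin

section \<open>Weighted graph homomorphisms\<close>

text \<open>The case \<lambda> = 1 stands apart because an automorphism that preserves vertex
  weights may move a vertex within its weight level or permute parallel edges; the quotient by its
  powers then need not have \<Gamma> as tracial cover. For \<lambda> \<noteq> 1 the powers scale w_V
  by pairwise distinct factors, so a nontrivial power fixes no vertex and out-arcs of a vertex are
  never identified. Local conditions then descend to the quotient at once. The involution is the
  obstacle: it is chosen without regard to the automorphism. What survives is a count, since
  \<Gamma> has as many edges from u to v as from v to u, and an involution of the quotient is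
  rebuilt from such counts. A second constraint is that \<Lambda> has to live on prescribed infinite
  types, so even \<Gamma> itself must be copied; this is done by treating it as the quotient by a
  trivial action.\<close>

lemma path_weight_simps [simp]:
  "path_weight \<Gamma> [] = 1"
  "path_weight \<Gamma> (e # p) = weight \<Gamma> e * path_weight \<Gamma> p"
  "path_weight \<Gamma> (p @ q) = path_weight \<Gamma> p * path_weight \<Gamma> q"
  by (simp_all add: path_weight_def)

text \<open>Pairs of maps, constrained only on vertices and arcs, avoid the \<open>iso_head\<close>
  and \<open>iso_tail\<close> fields of \<open>digraph_isomorphism\<close>. The same notion also
  covers the projection to a quotient and the elements of an action.\<close>

definition wgraph_hom ::
  "('a, 'b) wgraph \<Rightarrow> ('c, 'd) wgraph \<Rightarrow> ('a \<Rightarrow> 'c) \<Rightarrow> ('b \<Rightarrow> 'd) \<Rightarrow> bool" where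
  "wgraph_hom A B f g \<longleftrightarrow>
     (\<forall>v \<in> verts (dgraph A). f v \<in> verts (dgraph B)) \<and>
     (\<forall>e \<in> arcs (dgraph A). g e \<in> arcs (dgraph B) \<and>
        tail (dgraph B) (g e) = f (tail (dgraph A) e) \<and>
        head (dgraph B) (g e) = f (head (dgraph A) e) \<and>
        weight B (g e) = weight A e)"

definition wgraph_iso ::
  "('a, 'b) wgraph \<Rightarrow> ('c, 'd) wgraph \<Rightarrow> ('a \<Rightarrow> 'c) \<Rightarrow> ('b \<Rightarrow> 'd) \<Rightarrow> bool" where
  "wgraph_iso A B f g \<longleftrightarrow> wgraph_hom A B f g \<and>
     bij_betw f (verts (dgraph A)) (verts (dgraph B)) \<and>
     bij_betw g (arcs (dgraph A)) (arcs (dgraph B))"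

lemma wgraph_hom_awalk:
  assumes "wgraph_hom A B f g" "wf_digraph (dgraph A)"
    and "pre_digraph.awalk (dgraph A) u p v"
  shows "pre_digraph.awalk (dgraph B) (f u) (map g p) (f v)"
    and "path_weight B (map g p) = path_weight A p"
proof -
  have "pre_digraph.awalk (dgraph B) (f u) (map g p) (f v) \<and>
      path_weight B (map g p) = path_weight A p"
    using assms(3)
  proof (induction p arbitrary: u)
    case Nil
    then show ?case
      using assms(1) by (auto simp: pre_digraph.awalk_def pre_digraph.cas.simps wgraph_hom_def)
  next
    case (Cons e p)
    then have "pre_digraph.awalk (dgraph A) (head (dgraph A) e) p v"
      using assms(2) by (simp add: wf_digraph.awalk_Cons_iff)
    with Cons show ?case
      using assms(1) by (auto simp: pre_digraph.awalk_def pre_digraph.cas.simps wgraph_hom_def)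
  qed
  then show "pre_digraph.awalk (dgraph B) (f u) (map g p) (f v)"
    and "path_weight B (map g p) = path_weight A p"
    by auto
qed

lemma wgraph_iso_inv:
  assumes "wgraph_iso A B f g" "wf_digraph (dgraph A)"
  shows "wgraph_iso B A (inv_into (verts (dgraph A)) f) (inv_into (arcs (dgraph A)) g)"
proof -
  let ?f = "inv_into (verts (dgraph A)) f" and ?g = "inv_into (arcs (dgraph A)) g"
  have bij: "bij_betw f (verts (dgraph A)) (verts (dgraph B))"
      "bij_betw g (arcs (dgraph A)) (arcs (dgraph B))"
    and hom: "wgraph_hom A B f g"
    using assms(1) by (auto simp: wgraph_iso_def)
  note inv = bij_betw_inv_into[OF bij(1)] bij_betw_inv_into[OF bij(2)]
  have "tail (dgraph A) (?g e) = ?f (tail (dgraph B) e) \<and>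
      head (dgraph A) (?g e) = ?f (head (dgraph B) e) \<and> weight A (?g e) = weight B e"
    if e: "e \<in> arcs (dgraph B)" for e
  proof -
    have a: "?g e \<in> arcs (dgraph A)" "g (?g e) = e"
      using inv(2) e bij_betw_inv_into_right[OF bij(2)] by (auto dest: bij_betwE)
    have t: "tail (dgraph A) (?g e) \<in> verts (dgraph A)" "head (dgraph A) (?g e) \<in> verts (dgraph A)"
      using a(1) assms(2) by (auto simp: wf_digraph.tail_in_verts wf_digraph.head_in_verts)
    have "tail (dgraph B) e = f (tail (dgraph A) (?g e)) \<and>
        head (dgraph B) e = f (head (dgraph A) (?g e)) \<and> weight B e = weight A (?g e)"
      using hom a unfolding wgraph_hom_def by metis
    then show ?thesis
      using t bij_betw_inv_into_left[OF bij(1)] by metis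
  qed
  then show ?thesis
    using inv by (auto simp: wgraph_iso_def wgraph_hom_def dest: bij_betwE)
qed

lemma wgraph_iso_comp:
  assumes "wgraph_iso A B f g" "wgraph_iso B C f' g'" "wf_digraph (dgraph A)"
  shows "wgraph_iso A C (f' \<circ> f) (g' \<circ> g)"
  using assms
  by (auto simp: wgraph_iso_def wgraph_hom_def wf_digraph_def intro: bij_betw_trans)

lemma weighted_isomorphism_imp_wgraph_iso:
  assumes "weighted_isomorphism A B \<phi>"
  shows "wgraph_iso A B (iso_verts \<phi>) (iso_arcs \<phi>)"
  using assms
  by (auto simp: weighted_isomorphism_def wgraph_iso_def wgraph_hom_def bij_betw_def
      pre_digraph.digraph_isomorphism_def)

text \<open>Taking \<open>iso_head\<close> and \<open>iso_tail\<close> to be the head and tail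
  functions of the target makes the record equation with \<open>app_iso\<close> hold literally, also
  outside the arcs.\<close>

lemma wgraph_iso_imp_weighted_isomorphism:
  assumes "wgraph_iso A B f g" "wf_digraph (dgraph A)"
  obtains \<phi> where "weighted_isomorphism A B \<phi>" "iso_verts \<phi> = f" "iso_arcs \<phi> = g"
proof
  let ?\<phi> = "\<lparr>iso_verts = f, iso_arcs = g, iso_head = head (dgraph B), iso_tail = tail (dgraph B)\<rparr>"
  show "weighted_isomorphism A B ?\<phi>"
    using assms
    by (auto simp: weighted_isomorphism_def wgraph_iso_def wgraph_hom_def bij_betw_def
        pre_digraph.digraph_isomorphism_def app_iso_def)
qed simp_all

section \<open>Fair and balanced graphs\<close>

locale fair_balanced_graph =
  fixes \<delta> :: real and \<Gamma> :: "('v, 'e) wgraph"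
  assumes fair_balanced: "fair_balanced \<delta> \<Gamma>"
begin

sublocale wf_digraph "dgraph \<Gamma>"
  using fair_balanced by (simp add: fair_balanced_def)

lemma base_in_verts: "base \<Gamma> \<in> verts (dgraph \<Gamma>)"
  and finite_out_arcs: "x \<in> verts (dgraph \<Gamma>) \<Longrightarrow> finite (out_arcs (dgraph \<Gamma>) x)"
  and finite_in_arcs: "x \<in> verts (dgraph \<Gamma>) \<Longrightarrow> finite (in_arcs (dgraph \<Gamma>) x)"
  and weight_pos: "e \<in> arcs (dgraph \<Gamma>) \<Longrightarrow> weight \<Gamma> e > 0"
  and out_weight_sum: "x \<in> verts (dgraph \<Gamma>) \<Longrightarrow> (\<Sum>e \<in> out_arcs (dgraph \<Gamma>) x. weight \<Gamma> e) = \<delta>"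
  using fair_balanced by (auto simp: fair_balanced_def)

lemma reversal:
  obtains r where "\<And>e. e \<in> arcs (dgraph \<Gamma>) \<Longrightarrow> r e \<in> arcs (dgraph \<Gamma>)"
    and "\<And>e. e \<in> arcs (dgraph \<Gamma>) \<Longrightarrow> r (r e) = e"
    and "\<And>e. e \<in> arcs (dgraph \<Gamma>) \<Longrightarrow> tail (dgraph \<Gamma>) (r e) = head (dgraph \<Gamma>) e"
    and "\<And>e. e \<in> arcs (dgraph \<Gamma>) \<Longrightarrow> head (dgraph \<Gamma>) (r e) = tail (dgraph \<Gamma>) e"
    and "\<And>e. e \<in> arcs (dgraph \<Gamma>) \<Longrightarrow> weight \<Gamma> (r e) = inverse (weight \<Gamma> e)"
proof -
  obtain r where r: "\<forall>e \<in> arcs (dgraph \<Gamma>).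
      r e \<in> arcs (dgraph \<Gamma>) \<and> r (r e) = e \<and>
      tail (dgraph \<Gamma>) (r e) = head (dgraph \<Gamma>) e \<and>
      head (dgraph \<Gamma>) (r e) = tail (dgraph \<Gamma>) e \<and>
      weight \<Gamma> e * weight \<Gamma> (r e) = 1"
    using fair_balanced unfolding fair_balanced_def by blast
  moreover have "weight \<Gamma> (r e) = inverse (weight \<Gamma> e)" if "e \<in> arcs (dgraph \<Gamma>)" for e
    using r that by (metis inverse_unique)
  ultimately show thesis by (intro that[of r]) auto
qed

text \<open>Connectedness only speaks of the symmetrised graph. The involution makes the graph
  symmetric, hence strongly connected, so directed paths suffice.\<close>

lemma ex_awalk:
  assumes "u \<in> verts (dgraph \<Gamma>)" "v \<in> verts (dgraph \<Gamma>)"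
  obtains p where "awalk u p v"
proof -
  obtain r where "\<And>e. e \<in> arcs (dgraph \<Gamma>) \<Longrightarrow> r e \<in> arcs (dgraph \<Gamma>)"
    and "\<And>e. e \<in> arcs (dgraph \<Gamma>) \<Longrightarrow> tail (dgraph \<Gamma>) (r e) = head (dgraph \<Gamma>) e"
    and "\<And>e. e \<in> arcs (dgraph \<Gamma>) \<Longrightarrow> head (dgraph \<Gamma>) (r e) = tail (dgraph \<Gamma>) e"
    by (rule reversal) blast
  then have "symmetric (dgraph \<Gamma>)"
    unfolding symmetric_conv by metis
  then have "strongly_connected (dgraph \<Gamma>)"
    using fair_balanced by (simp add: fair_balanced_def symmetric_connected_imp_strongly_connected)
  then show thesis
    using assms that by (auto simp: strongly_connected_def reachable_awalk)
qed

lemma path_weight_pos: "awalk u p v \<Longrightarrow> path_weight \<Gamma> p > 0"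
  by (induction p arbitrary: u) (auto simp: awalk_Cons_iff weight_pos)

lemma awalk_reverse:
  assumes "awalk u p v"
  obtains q where "awalk v q u" "path_weight \<Gamma> q = inverse (path_weight \<Gamma> p)"
proof -
  obtain r where r: "\<And>e. e \<in> arcs (dgraph \<Gamma>) \<Longrightarrow> r e \<in> arcs (dgraph \<Gamma>)"
    "\<And>e. e \<in> arcs (dgraph \<Gamma>) \<Longrightarrow> tail (dgraph \<Gamma>) (r e) = head (dgraph \<Gamma>) e"
    "\<And>e. e \<in> arcs (dgraph \<Gamma>) \<Longrightarrow> head (dgraph \<Gamma>) (r e) = tail (dgraph \<Gamma>) e"
    "\<And>e. e \<in> arcs (dgraph \<Gamma>) \<Longrightarrow> weight \<Gamma> (r e) = inverse (weight \<Gamma> e)"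
    by (rule reversal) blast
  have "\<exists>q. awalk v q u \<and> path_weight \<Gamma> q = inverse (path_weight \<Gamma> p)"
    using assms
  proof (induction p arbitrary: u)
    case Nil
    then show ?case by (intro exI[of _ "[]"]) (auto simp: awalk_Nil_iff)
  next
    case (Cons e p)
    then have e: "e \<in> arcs (dgraph \<Gamma>)" "tail (dgraph \<Gamma>) e = u"
      and "awalk (head (dgraph \<Gamma>) e) p v"
      by (auto simp: awalk_Cons_iff)
    with Cons.IH obtain q where q: "awalk v q (head (dgraph \<Gamma>) e)"
      "path_weight \<Gamma> q = inverse (path_weight \<Gamma> p)"
      by blast
    have "awalk (head (dgraph \<Gamma>) e) [r e] u"
      using e r by (auto simp: awalk_Cons_iff awalk_Nil_iff)
    with q have "awalk v (q @ [r e]) u"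
      by (meson awalk_appendI)
    then show ?case
      using q e r by (intro exI[of _ "q @ [r e]"]) simp
  qed
  then show thesis using that by blast
qed

text \<open>By local finiteness only finitely many vertices end a path of length n from the base.
  Countability is what later lets orbits be named in an arbitrary infinite type.\<close>

lemma countable_verts: "countable (verts (dgraph \<Gamma>))"
proof -
  have "finite {v. \<exists>p. awalk (base \<Gamma>) p v \<and> length p = n}" (is "finite (?S n)") for n
  proof (induction n)
    case 0
    have "?S 0 \<subseteq> {base \<Gamma>}" by (auto simp: awalk_Nil_iff)
    then show ?case by (rule finite_subset) simp
  next
    case (Suc n)
    have "?S (Suc n) \<subseteq> (\<Union>v \<in> ?S n. head (dgraph \<Gamma>) ` out_arcs (dgraph \<Gamma>) v)"
    proof
      fix w assume "w \<in> ?S (Suc n)"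
      then obtain p e where "awalk (base \<Gamma>) (p @ [e]) w" "length p = n"
        by (auto simp: length_Suc_conv_rev)
      then have "awlast (base \<Gamma>) p \<in> ?S n" "e \<in> out_arcs (dgraph \<Gamma>) (awlast (base \<Gamma>) p)"
        "w = head (dgraph \<Gamma>) e"
        by (auto simp: awalk_Cons_iff awalk_Nil_iff)
      then show "w \<in> (\<Union>v \<in> ?S n. head (dgraph \<Gamma>) ` out_arcs (dgraph \<Gamma>) v)" by blast
    qed
    moreover have "finite (\<Union>v \<in> ?S n. head (dgraph \<Gamma>) ` out_arcs (dgraph \<Gamma>) v)"
      using Suc by (auto intro!: finite_out_arcs)
    ultimately show ?case by (rule finite_subset)
  qed
  moreover have "verts (dgraph \<Gamma>) \<subseteq> (\<Union>n. ?S n)"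
    using ex_awalk[OF base_in_verts] by blast
  ultimately show ?thesis
    by (meson countable_UN countable_finite countable_subset countableI_type)
qed

lemma countable_arcs: "countable (arcs (dgraph \<Gamma>))"
proof -
  have "arcs (dgraph \<Gamma>) \<subseteq> (\<Union>v \<in> verts (dgraph \<Gamma>). out_arcs (dgraph \<Gamma>) v)"
    by auto
  moreover have "countable (\<Union>v \<in> verts (dgraph \<Gamma>). out_arcs (dgraph \<Gamma>) v)"
    by (intro countable_UN countable_verts countable_finite finite_out_arcs)
  ultimately show ?thesis by (rule countable_subset)
qed

section \<open>The tracial cover: scaling by loop weights and lifting of paths\<close>

lemma cover_verts_pos: "(l, v) \<in> cover_verts \<Gamma> \<Longrightarrow> l > 0"
  by (auto simp: cover_verts_def path_weight_pos)

lemma loop_scales_cover_verts: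
  assumes "r \<in> loop_weights \<Gamma>" "(l, v) \<in> cover_verts \<Gamma>"
  shows "(r * l, v) \<in> cover_verts \<Gamma>"
proof -
  obtain p q where "awalk (base \<Gamma>) p (base \<Gamma>)" "r = path_weight \<Gamma> p"
    "awalk (base \<Gamma>) q v" "l = path_weight \<Gamma> q"
    using assms by (auto simp: loop_weights_def cover_verts_def)
  then show ?thesis
    unfolding cover_verts_def
    by (auto intro!: exI[of _ "p @ q"] awalk_appendI)
qed

lemma inverse_loop_weight:
  assumes "r \<in> loop_weights \<Gamma>"
  shows "inverse r \<in> loop_weights \<Gamma>"
proof -
  obtain p where p: "awalk (base \<Gamma>) p (base \<Gamma>)" "r = path_weight \<Gamma> p"
    using assms by (auto simp: loop_weights_def)
  from awalk_reverse[OF p(1)] p(2) show ?thesis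
    unfolding loop_weights_def by (smt (verit) mem_Collect_eq)
qed

lemma loop_weight_pos: "r \<in> loop_weights \<Gamma> \<Longrightarrow> r > 0"
  by (auto simp: loop_weights_def path_weight_pos)

lemma wf_tracial_cover: "wf_digraph (dgraph (tracial_cover \<Gamma>))"
  by unfold_locales (auto simp: tracial_cover_def)

text \<open>Scaling both ends leaves the quotient l' / l of an edge unchanged, so edges go to edges.
  The inverse map scales by \<open>inverse r\<close>, which is again a loop weight because loops can
  be run backwards.\<close>

lemma loop_scaling_iso:
  assumes r: "r \<in> loop_weights \<Gamma>"
  defines "s \<equiv> \<lambda>(l, v). (r * l, v)"
  shows "wgraph_iso (tracial_cover \<Gamma>) (tracial_cover \<Gamma>) s (\<lambda>(x, e, y). (s x, e, s y))"
proof -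
  have r0: "r > 0" using r by (rule loop_weight_pos)
  define t :: "real \<times> 'v \<Rightarrow> real \<times> 'v" where "t = (\<lambda>(l, v). (inverse r * l, v))"
  have st: "s (t x) = x" "t (s x) = x" for x
    using r0 by (auto simp: s_def t_def split: prod.splits)
  have sV: "s x \<in> cover_verts \<Gamma>" "t x \<in> cover_verts \<Gamma>" if "x \<in> cover_verts \<Gamma>" for x
    using that loop_scales_cover_verts[OF r] loop_scales_cover_verts[OF inverse_loop_weight[OF r]]
    by (auto simp: s_def t_def split: prod.splits)
  have sA: "(s x, e, s y) \<in> arcs (dgraph (tracial_cover \<Gamma>))"
    "(t x, e, t y) \<in> arcs (dgraph (tracial_cover \<Gamma>))"
    if "(x, e, y) \<in> arcs (dgraph (tracial_cover \<Gamma>))" for x e y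
    using that sV r0 by (auto simp: tracial_cover_def s_def t_def split: prod.splits)
  have "bij_betw s (cover_verts \<Gamma>) (cover_verts \<Gamma>)"
    by (rule bij_betwI[where g = t]) (use st sV in auto)
  moreover have "bij_betw (\<lambda>(x, e, y). (s x, e, s y))
      (arcs (dgraph (tracial_cover \<Gamma>))) (arcs (dgraph (tracial_cover \<Gamma>)))"
    by (rule bij_betwI[where g = "\<lambda>(x, e, y). (t x, e, t y)"])
      (use st sA in auto)
  moreover have "wgraph_hom (tracial_cover \<Gamma>) (tracial_cover \<Gamma>) s (\<lambda>(x, e, y). (s x, e, s y))"
    using sV sA by (auto simp: wgraph_hom_def tracial_cover_def)
  ultimately show ?thesis
    by (simp add: wgraph_iso_def tracial_cover_def)
qed

text \<open>The second coordinate follows the path while the first accumulates its weight. A loop at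
  the base of weight r thus lifts to a path from (1, base) to (r, base), which exhibits r as a path
  weight in the cover.\<close>

lemma cover_lift:
  assumes "awalk u p v" "(l, u) \<in> cover_verts \<Gamma>"
  obtains q where
    "pre_digraph.awalk (dgraph (tracial_cover \<Gamma>)) (l, u) q (l * path_weight \<Gamma> p, v)"
    "path_weight (tracial_cover \<Gamma>) q = path_weight \<Gamma> p"
proof -
  interpret C: wf_digraph "dgraph (tracial_cover \<Gamma>)" by (rule wf_tracial_cover)
  have "\<exists>q. C.awalk (l, u) q (l * path_weight \<Gamma> p, v) \<and>
      path_weight (tracial_cover \<Gamma>) q = path_weight \<Gamma> p"
    using assms
  proof (induction p arbitrary: l u)
    case Nil
    then have "(l, u) \<in> verts (dgraph (tracial_cover \<Gamma>))"
      by (simp add: tracial_cover_def)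
    with Nil show ?case
      by (intro exI[of _ "[]"]) (auto simp: awalk_Nil_iff C.awalk_Nil_iff)
  next
    case (Cons e p)
    let ?l = "l * weight \<Gamma> e" and ?w = "head (dgraph \<Gamma>) e"
    have e: "e \<in> arcs (dgraph \<Gamma>)" "tail (dgraph \<Gamma>) e = u" and p: "awalk ?w p v"
      using Cons.prems(1) by (auto simp: awalk_Cons_iff)
    obtain a where a: "awalk (base \<Gamma>) a u" "l = path_weight \<Gamma> a"
      using Cons.prems(2) by (auto simp: cover_verts_def)
    have "awalk (base \<Gamma>) (a @ [e]) ?w"
      using a(1) e by (auto intro!: awalk_appendI simp: awalk_Cons_iff awalk_Nil_iff)
    then have w: "(?l, ?w) \<in> cover_verts \<Gamma>"
      unfolding cover_verts_def using a(2) e(1) by (auto intro!: exI[of _ "a @ [e]"])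
    from Cons.IH[OF p w] obtain q where q: "C.awalk (?l, ?w) q (?l * path_weight \<Gamma> p, v)"
      "path_weight (tracial_cover \<Gamma>) q = path_weight \<Gamma> p"
      by blast
    let ?e = "((l, u), e, (?l, ?w))"
    have "?e \<in> arcs (dgraph (tracial_cover \<Gamma>))"
      using Cons.prems(2) w e cover_verts_pos[OF Cons.prems(2)] by (auto simp: tracial_cover_def)
    moreover have "tail (dgraph (tracial_cover \<Gamma>)) ?e = (l, u)"
      "head (dgraph (tracial_cover \<Gamma>)) ?e = (?l, ?w)" "weight (tracial_cover \<Gamma>) ?e = weight \<Gamma> e"
      by (auto simp: tracial_cover_def)
    ultimately show ?case
      using q by (intro exI[of _ "?e # q"]) (auto simp: C.awalk_Cons_iff mult.assoc)
  qed
  then show thesis using that by blast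
qed

end

section \<open>Tracial graphs\<close>

locale tracial_graph = fair_balanced_graph \<delta> \<Gamma>
  for \<delta> :: real and \<Gamma> :: "('v, 'e) wgraph" +
  assumes tracial: "tracial \<Gamma>"
begin

text \<open>Any other path q to v followed by the reverse of p is a loop at the base, so its weight
  is 1 and q weighs the same as p. This justifies the definite description.\<close>

lemma vertex_weight_eq:
  assumes "awalk (base \<Gamma>) p v"
  shows "vertex_weight \<Gamma> v = path_weight \<Gamma> p"
  unfolding vertex_weight_def
proof (rule the_equality)
  show "\<exists>q. awalk (base \<Gamma>) q v \<and> path_weight \<Gamma> p = path_weight \<Gamma> q"
    using assms by blast
next
  fix r assume "\<exists>q. awalk (base \<Gamma>) q v \<and> r = path_weight \<Gamma> q"
  then obtain q where q: "awalk (base \<Gamma>) q v" "r = path_weight \<Gamma> q" by blast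
  obtain p' where p': "awalk v p' (base \<Gamma>)" "path_weight \<Gamma> p' = inverse (path_weight \<Gamma> p)"
    using assms by (rule awalk_reverse)
  have "awalk (base \<Gamma>) (q @ p') (base \<Gamma>)"
    using q(1) p'(1) by (rule awalk_appendI)
  then have "path_weight \<Gamma> (q @ p') \<in> loop_weights \<Gamma>"
    unfolding loop_weights_def by blast
  then have "path_weight \<Gamma> (q @ p') = 1"
    using tracial by (simp add: tracial_def)
  then show "r = path_weight \<Gamma> p"
    using q(2) p'(2) path_weight_pos[OF assms] by (simp add: field_simps)
qed

lemma vertex_weight_awalk:
  assumes "awalk u p v"
  shows "vertex_weight \<Gamma> v = vertex_weight \<Gamma> u * path_weight \<Gamma> p"
proof -
  obtain q where q: "awalk (base \<Gamma>) q u"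
    using ex_awalk[OF base_in_verts] assms by blast
  then show ?thesis
    using vertex_weight_eq[OF q] vertex_weight_eq[OF awalk_appendI[OF q assms]] by simp
qed

lemma vertex_weight_base: "vertex_weight \<Gamma> (base \<Gamma>) = 1"
  using vertex_weight_eq[of "[]" "base \<Gamma>"] base_in_verts by (simp add: awalk_Nil_iff)

lemma vertex_weight_pos:
  assumes "v \<in> verts (dgraph \<Gamma>)"
  shows "vertex_weight \<Gamma> v > 0"
proof -
  obtain q where "awalk (base \<Gamma>) q v"
    using ex_awalk[OF base_in_verts assms] .
  then show ?thesis by (simp add: vertex_weight_eq path_weight_pos)
qed

lemma vertex_weight_head:
  assumes "e \<in> arcs (dgraph \<Gamma>)"
  shows "vertex_weight \<Gamma> (head (dgraph \<Gamma>) e) = vertex_weight \<Gamma> (tail (dgraph \<Gamma>) e) * weight \<Gamma> e"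
  using vertex_weight_awalk[of "tail (dgraph \<Gamma>) e" "[e]"] assms
  by (simp add: awalk_Cons_iff awalk_Nil_iff)

text \<open>The image of a path from the base to v runs from \<open>f (base \<Gamma>)\<close> to
  \<open>f v\<close> with the same weight.\<close>

lemma vertex_weight_hom:
  assumes "wgraph_hom \<Gamma> \<Gamma> f g" "v \<in> verts (dgraph \<Gamma>)"
  shows "vertex_weight \<Gamma> (f v) = vertex_weight \<Gamma> (f (base \<Gamma>)) * vertex_weight \<Gamma> v"
proof -
  obtain p where p: "awalk (base \<Gamma>) p v"
    using ex_awalk[OF base_in_verts assms(2)] .
  show ?thesis
    using vertex_weight_awalk[OF wgraph_hom_awalk(1)[OF assms(1) wf_digraph_axioms p]]
      wgraph_hom_awalk(2)[OF assms(1) wf_digraph_axioms p] vertex_weight_eq[OF p]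
    by simp
qed

section \<open>From loops to automorphisms\<close>

lemma loop_weight_in_W_times:
  fixes \<Lambda> :: "('a, 'b) wgraph"
  assumes "fair_balanced \<epsilon> \<Lambda>" and "pointed_isomorphic (tracial_cover \<Lambda>) \<Gamma>"
    and r: "r \<in> loop_weights \<Lambda>"
  shows "r \<in> W_times \<Gamma>"
proof -
  interpret L: fair_balanced_graph \<epsilon> \<Lambda> by unfold_locales fact
  let ?C = "tracial_cover \<Lambda>"
  define s :: "real \<times> 'a \<Rightarrow> real \<times> 'a" where "s = (\<lambda>(l, v). (r * l, v))"
  obtain \<phi> where "weighted_isomorphism ?C \<Gamma> \<phi>" and \<phi>: "iso_verts \<phi> (base ?C) = base \<Gamma>"
    using assms(2) by (auto simp: pointed_isomorphic_def)
  then have iso: "wgraph_iso ?C \<Gamma> (iso_verts \<phi>) (iso_arcs \<phi>)"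
    by (simp add: weighted_isomorphism_imp_wgraph_iso)
  note wf = L.wf_tracial_cover
  define f where "f = inv_into (verts (dgraph ?C)) (iso_verts \<phi>)"
  define g where "g = inv_into (arcs (dgraph ?C)) (iso_arcs \<phi>)"
  have "wgraph_iso \<Gamma> ?C f g"
    unfolding f_def g_def by (rule wgraph_iso_inv[OF iso wf])
  from wgraph_iso_comp[OF wgraph_iso_comp[OF this L.loop_scaling_iso[OF r] wf_digraph_axioms]
      iso wf_digraph_axioms]
  obtain \<alpha> where "weighted_isomorphism \<Gamma> \<Gamma> \<alpha>" and \<alpha>: "iso_verts \<alpha> = iso_verts \<phi> \<circ> (s \<circ> f)"
    unfolding s_def by (rule wgraph_iso_imp_weighted_isomorphism[OF _ wf_digraph_axioms])
  then have Aut: "\<alpha> \<in> Aut \<Gamma>" by (simp add: Aut_def)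
  obtain p where p: "pre_digraph.awalk (dgraph \<Lambda>) (base \<Lambda>) p (base \<Lambda>)" "r = path_weight \<Lambda> p"
    using r by (auto simp: loop_weights_def)
  have b: "(1, base \<Lambda>) \<in> cover_verts \<Lambda>"
    unfolding cover_verts_def
    using L.base_in_verts by (auto intro!: exI[of _ "[]"] simp: L.awalk_Nil_iff)
  \<comment> \<open>The image under \<phi> of this lifted loop runs from the base of \<Gamma> to the
    vertex where \<alpha> sends it, so the weight r of the lift is the vertex weight sought.\<close>
  obtain q where q: "pre_digraph.awalk (dgraph ?C) (1, base \<Lambda>) q (r, base \<Lambda>)"
    "path_weight ?C q = r"
    using L.cover_lift[OF p(1) b] p(2) by auto
  have base: "base ?C = (1, base \<Lambda>)" "verts (dgraph ?C) = cover_verts \<Lambda>"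
    by (simp_all add: tracial_cover_def)
  have hom: "wgraph_hom ?C \<Gamma> (iso_verts \<phi>) (iso_arcs \<phi>)" "inj_on (iso_verts \<phi>) (verts (dgraph ?C))"
    using iso by (auto simp: wgraph_iso_def bij_betw_def)
  have "f (base \<Gamma>) = (1, base \<Lambda>)"
    using inv_into_f_f[OF hom(2), of "(1, base \<Lambda>)"] b base \<phi> by (simp add: f_def)
  then have "iso_verts \<alpha> (base \<Gamma>) = iso_verts \<phi> (r, base \<Lambda>)"
    by (simp add: \<alpha> s_def)
  moreover have "vertex_weight \<Gamma> (iso_verts \<phi> (r, base \<Lambda>)) = r"
    using vertex_weight_eq wgraph_hom_awalk[OF hom(1) wf q(1)] \<phi> base q(2) by simp
  ultimately show ?thesis
    unfolding W_times_def using Aut by force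
qed

section \<open>Recognising a tracial cover\<close>

text \<open>A projection that is bijective on out-arcs at every vertex, and whose fibres are
  separated by vertex weight, is the tracial cover. The isomorphism sends v to its weight together
  with its projection.\<close>

lemma covering_imp_cover_iso:
  fixes \<Lambda> :: "('a, 'b) wgraph"
  assumes wf: "wf_digraph (dgraph \<Lambda>)" and hom: "wgraph_hom \<Gamma> \<Lambda> P Q"
    and base: "P (base \<Gamma>) = base \<Lambda>"
    and inj: "\<And>x. x \<in> verts (dgraph \<Gamma>) \<Longrightarrow> inj_on Q (out_arcs (dgraph \<Gamma>) x)"
    and surj: "\<And>x. x \<in> verts (dgraph \<Gamma>) \<Longrightarrow>
      out_arcs (dgraph \<Lambda>) (P x) \<subseteq> Q ` out_arcs (dgraph \<Gamma>) x"
    and sep: "inj_on (\<lambda>v. (vertex_weight \<Gamma> v, P v)) (verts (dgraph \<Gamma>))"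
  shows "pointed_isomorphic (tracial_cover \<Lambda>) \<Gamma>"
proof -
  interpret L: wf_digraph "dgraph \<Lambda>" by (rule wf)
  let ?C = "tracial_cover \<Lambda>"
  define f where "f = (\<lambda>v. (vertex_weight \<Gamma> v, P v))"
  define g where "g = (\<lambda>e. (f (tail (dgraph \<Gamma>) e), Q e, f (head (dgraph \<Gamma>) e)))"
  \<comment> \<open>Path lifting gives surjectivity of \<open>f\<close>: a vertex of the cover is
    the weight and end point of some path q in \<Lambda>, and the lift of q ends at a
    preimage.\<close>
  have lift: "\<exists>p z. awalk u p z \<and> map Q p = q \<and> P z = y"
    if "L.awalk (P u) q y" "u \<in> verts (dgraph \<Gamma>)" for u q y
    using that
  proof (induction q arbitrary: u)
    case Nil
    then show ?case
      by (intro exI[of _ "[]"] exI[of _ u]) (auto simp: awalk_Nil_iff L.awalk_Nil_iff)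
  next
    case (Cons d q)
    then have d: "d \<in> out_arcs (dgraph \<Lambda>) (P u)" "L.awalk (head (dgraph \<Lambda>) d) q y"
      by (auto simp: L.awalk_Cons_iff)
    then obtain e where e: "e \<in> arcs (dgraph \<Gamma>)" "tail (dgraph \<Gamma>) e = u" "d = Q e"
      using surj[OF Cons.prems(2)] by fastforce
    then have "L.awalk (P (head (dgraph \<Gamma>) e)) q y"
      using d(2) hom by (simp add: wgraph_hom_def)
    from Cons.IH[OF this head_in_verts[OF e(1)]]
    obtain p z where "awalk (head (dgraph \<Gamma>) e) p z" "map Q p = q" "P z = y"
      by blast
    then show ?case
      using e by (intro exI[of _ "e # p"] exI[of _ z]) (auto simp: awalk_Cons_iff)
  qed
  have f_image: "f ` verts (dgraph \<Gamma>) = cover_verts \<Lambda>"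
  proof (intro equalityI subsetI)
    fix x assume "x \<in> f ` verts (dgraph \<Gamma>)"
    then obtain v where v: "v \<in> verts (dgraph \<Gamma>)" "x = f v" by blast
    obtain p where p: "awalk (base \<Gamma>) p v" using ex_awalk[OF base_in_verts v(1)] .
    then show "x \<in> cover_verts \<Lambda>"
      using wgraph_hom_awalk[OF hom wf_digraph_axioms p] vertex_weight_eq[OF p] v base hom
      unfolding cover_verts_def
      by (auto simp: f_def wgraph_hom_def intro!: exI[of _ "map Q p"])
  next
    fix x assume "x \<in> cover_verts \<Lambda>"
    then obtain q y where q: "L.awalk (P (base \<Gamma>)) q y" "x = (path_weight \<Lambda> q, y)"
      using base by (auto simp: cover_verts_def)
    then obtain p z where p: "awalk (base \<Gamma>) p z" "map Q p = q" "P z = y"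
      using lift base_in_verts by blast
    then have "x = f z"
      using q wgraph_hom_awalk(2)[OF hom wf_digraph_axioms p(1)] vertex_weight_eq[OF p(1)]
      by (simp add: f_def)
    then show "x \<in> f ` verts (dgraph \<Gamma>)" using p(1) by auto
  qed
  have f_inj: "inj_on f (verts (dgraph \<Gamma>))" using sep by (simp add: f_def)
  have g_arc: "g e \<in> arcs (dgraph ?C)" if e: "e \<in> arcs (dgraph \<Gamma>)" for e
  proof -
    have "f (tail (dgraph \<Gamma>) e) \<in> cover_verts \<Lambda>" "f (head (dgraph \<Gamma>) e) \<in> cover_verts \<Lambda>"
      using e f_image by auto
    moreover have "vertex_weight \<Gamma> (tail (dgraph \<Gamma>) e) > 0"
      using e vertex_weight_pos by auto
    ultimately show ?thesis
      using e hom vertex_weight_head[OF e]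
      by (auto simp: g_def f_def tracial_cover_def wgraph_hom_def)
  qed
  have "inj_on g (arcs (dgraph \<Gamma>))"
  proof (rule inj_onI)
    fix e e' assume e: "e \<in> arcs (dgraph \<Gamma>)" "e' \<in> arcs (dgraph \<Gamma>)" "g e = g e'"
    then have "tail (dgraph \<Gamma>) e = tail (dgraph \<Gamma>) e'"
      using f_inj by (auto simp: g_def dest: inj_onD)
    then show "e = e'"
      using e inj[of "tail (dgraph \<Gamma>) e"] by (auto simp: g_def dest: inj_onD)
  qed
  moreover have "x \<in> g ` arcs (dgraph \<Gamma>)" if x_arc: "x \<in> arcs (dgraph ?C)" for x
  proof -
    obtain l d l' where x: "x = ((l, tail (dgraph \<Lambda>) d), d, (l', head (dgraph \<Lambda>) d))"
      "(l, tail (dgraph \<Lambda>) d) \<in> cover_verts \<Lambda>"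
      "d \<in> arcs (dgraph \<Lambda>)" "weight \<Lambda> d = l' / l"
      using x_arc by (auto simp: tracial_cover_def)
    then obtain u where u: "u \<in> verts (dgraph \<Gamma>)" "(l, tail (dgraph \<Lambda>) d) = f u"
      using f_image by (metis imageE)
    then have "d \<in> out_arcs (dgraph \<Lambda>) (P u)"
      using x(3) by (simp add: f_def)
    then obtain e where e: "e \<in> arcs (dgraph \<Gamma>)" "tail (dgraph \<Gamma>) e = u" "d = Q e"
      using surj[OF u(1)] by fastforce
    \<comment> \<open>The lift e of d is chosen only by its tail. Its head lies over the right
      vertex of the cover because weights force the first coordinate to be l * (l' / l) =
      l'.\<close>
    have "vertex_weight \<Gamma> (head (dgraph \<Gamma>) e) = l * weight \<Gamma> e"
      using vertex_weight_head[OF e(1)] e(2) u(2) by (simp add: f_def)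
    moreover have "weight \<Lambda> d = weight \<Gamma> e" "head (dgraph \<Lambda>) d = P (head (dgraph \<Gamma>) e)"
      using hom e by (simp_all add: wgraph_hom_def)
    moreover have "l > 0" using u vertex_weight_pos by (simp add: f_def)
    ultimately have "f (head (dgraph \<Gamma>) e) = (l', head (dgraph \<Lambda>) d)"
      using x(4) by (simp add: f_def nonzero_divide_eq_eq mult.commute)
    then have "x = g e" using x(1) u(2) e by (simp add: g_def)
    then show ?thesis using e(1) by blast
  qed
  ultimately have "bij_betw g (arcs (dgraph \<Gamma>)) (arcs (dgraph ?C))"
    using g_arc by (auto simp: bij_betw_def)
  moreover have "bij_betw f (verts (dgraph \<Gamma>)) (verts (dgraph ?C))"
    using f_inj f_image by (simp add: bij_betw_def tracial_cover_def)
  moreover have "wgraph_hom \<Gamma> ?C f g"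
    using g_arc f_image hom by (auto simp: wgraph_hom_def tracial_cover_def g_def)
  ultimately have iso: "wgraph_iso \<Gamma> ?C f g" by (simp add: wgraph_iso_def)
  have "wf_digraph (dgraph ?C)"
    by unfold_locales (auto simp: tracial_cover_def)
  from wgraph_iso_imp_weighted_isomorphism[OF wgraph_iso_inv[OF iso wf_digraph_axioms] this]
  obtain \<phi> where \<phi>: "weighted_isomorphism ?C \<Gamma> \<phi>"
    "iso_verts \<phi> = inv_into (verts (dgraph \<Gamma>)) f" by blast
  have "base ?C = f (base \<Gamma>)"
    using base vertex_weight_base by (simp add: f_def tracial_cover_def)
  then have "iso_verts \<phi> (base ?C) = base \<Gamma>"
    using \<phi>(2) f_inj base_in_verts by simp
  with \<phi>(1) show ?thesis unfolding pointed_isomorphic_def by blast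
qed

end

section \<open>Involutions matching classes of equal size\<close>

text \<open>Meant for arcs classified by tail, head and weight, with \<sigma> swapping the ends and
  inverting the weight. On a class fixed by \<sigma> the constructed map is the identity; for arcs
  these are self-loops of weight 1, which an involution may fix.\<close>

lemma involution_of_card_eq:
  fixes c :: "'x \<Rightarrow> 'c"
  assumes invol: "\<And>x. x \<in> S \<Longrightarrow> \<sigma> (\<sigma> (c x)) = c x"
    and fin: "\<And>x. x \<in> S \<Longrightarrow> finite {y \<in> S. c y = c x}"
    and card: "\<And>x. x \<in> S \<Longrightarrow> card {y \<in> S. c y = \<sigma> (c x)} = card {y \<in> S. c y = c x}"
  obtains r where "\<And>x. x \<in> S \<Longrightarrow> r x \<in> S" "\<And>x. x \<in> S \<Longrightarrow> r (r x) = x"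
    "\<And>x. x \<in> S \<Longrightarrow> c (r x) = \<sigma> (c x)"
proof -
  define F where "F d = {y \<in> S. c y = d}" for d
  have "\<exists>b. finite (F d) \<longrightarrow> bij_betw b (F d) {0..<card (F d)}" for d
    using ex_bij_betw_finite_nat by blast
  then obtain b where b: "\<And>d. finite (F d) \<Longrightarrow> bij_betw (b d) (F d) {0..<card (F d)}"
    by metis
  \<comment> \<open>Composing the numbering of one class with the inverse numbering of the other class gives mutually
    inverse maps, so no choice between a class and its mirror image is needed.\<close>
  define r where "r x = inv_into (F (\<sigma> (c x))) (b (\<sigma> (c x))) (b (c x) x)" for x
  have r: "r x \<in> F (\<sigma> (c x)) \<and> b (\<sigma> (c x)) (r x) = b (c x) x" if x: "x \<in> S" for x
  proof -
    have c: "card (F (\<sigma> (c x))) = card (F (c x))" "finite (F (c x))" "x \<in> F (c x)"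
      using card[OF x] fin[OF x] x by (auto simp: F_def)
    \<comment> \<open>\<open>fin\<close> speaks of classes of elements of S only. Since infinite
      sets have \<open>card\<close> 0, a positive cardinality is what shows the mirror class to be
      finite.\<close>
    then have "card (F (\<sigma> (c x))) > 0" by (metis card_gt_0_iff empty_iff)
    then have bij: "bij_betw (b (\<sigma> (c x))) (F (\<sigma> (c x))) {0..<card (F (c x))}"
      using b c(1) by (metis card_gt_0_iff)
    have "b (c x) x \<in> {0..<card (F (c x))}"
      using b[OF c(2)] c(3) by (rule bij_betwE[THEN bspec])
    then show ?thesis
      unfolding r_def using bij by (metis bij_betw_imp_surj_on inv_into_into f_inv_into_f)
  qed
  have cr: "c (r x) = \<sigma> (c x)" "r x \<in> S" if "x \<in> S" for x
    using r[OF that] by (auto simp: F_def)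
  have "r (r x) = x" if x: "x \<in> S" for x
  proof -
    have "inj_on (b (c x)) (F (c x))" "x \<in> F (c x)"
      using b fin[OF x] x by (auto simp: F_def bij_betw_def)
    moreover have "r (r x) = inv_into (F (c x)) (b (c x)) (b (c x) x)"
      unfolding r_def[of "r x"] using cr(1)[OF x] r[OF x] invol[OF x] by simp
    ultimately show ?thesis by simp
  qed
  with cr show thesis using that by blast
qed

section \<open>Quotients by weight-free actions\<close>

text \<open>\<open>free\<close> asks for the identity on arcs as well as on vertices: an element
  that fixes all vertices but permutes parallel edges would merge arcs in the quotient.
  \<open>P\<close> and \<open>Q\<close> name the orbits by elements of the types prescribed for the
  quotient.\<close>

locale weight_free_quotient = tracial_graph \<delta> \<Gamma>
  for \<delta> :: real and \<Gamma> :: "('v, 'e) wgraph" +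
  fixes actV :: "'g \<Rightarrow> 'v \<Rightarrow> 'v" and actE :: "'g \<Rightarrow> 'e \<Rightarrow> 'e"
    and P :: "'v \<Rightarrow> 'a" and Q :: "'e \<Rightarrow> 'b"
  assumes act_hom: "\<And>k. wgraph_hom \<Gamma> \<Gamma> (actV k) (actE k)"
    and free: "\<And>k v. v \<in> verts (dgraph \<Gamma>) \<Longrightarrow> vertex_weight \<Gamma> (actV k v) = vertex_weight \<Gamma> v \<Longrightarrow>
      actV k = id \<and> actE k = id"
    and P_eq_iff: "\<And>u v. u \<in> verts (dgraph \<Gamma>) \<Longrightarrow> v \<in> verts (dgraph \<Gamma>) \<Longrightarrow>
      P u = P v \<longleftrightarrow> (\<exists>k. actV k u = v)"
    and Q_eq_iff: "\<And>d e. d \<in> arcs (dgraph \<Gamma>) \<Longrightarrow> e \<in> arcs (dgraph \<Gamma>) \<Longrightarrow>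
      Q d = Q e \<longleftrightarrow> (\<exists>k. actE k d = e)"
begin

lemma P_inj:
  assumes "u \<in> verts (dgraph \<Gamma>)" "v \<in> verts (dgraph \<Gamma>)" "P u = P v"
    and "vertex_weight \<Gamma> u = vertex_weight \<Gamma> v"
  shows "u = v"
  using assms P_eq_iff[of u v] free[of u] by (metis id_apply)

lemma Q_eq_imp:
  assumes "d \<in> arcs (dgraph \<Gamma>)" "e \<in> arcs (dgraph \<Gamma>)" "Q d = Q e"
  shows "P (tail (dgraph \<Gamma>) d) = P (tail (dgraph \<Gamma>) e)"
    and "P (head (dgraph \<Gamma>) d) = P (head (dgraph \<Gamma>) e)"
    and "weight \<Gamma> d = weight \<Gamma> e"
proof -
  obtain k where "actE k d = e" using assms Q_eq_iff by blast
  then have "actV k (tail (dgraph \<Gamma>) d) = tail (dgraph \<Gamma>) e"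
    "actV k (head (dgraph \<Gamma>) d) = head (dgraph \<Gamma>) e" "weight \<Gamma> d = weight \<Gamma> e"
    using act_hom[of k] assms(1) by (auto simp: wgraph_hom_def)
  then show "P (tail (dgraph \<Gamma>) d) = P (tail (dgraph \<Gamma>) e)"
    and "P (head (dgraph \<Gamma>) d) = P (head (dgraph \<Gamma>) e)"
    and "weight \<Gamma> d = weight \<Gamma> e"
    using assms P_eq_iff by auto
qed

text \<open>An element carrying one out-arc of x to another fixes x, hence preserves its weight, and
  is trivial by \<open>free\<close>.\<close>

lemma Q_inj_out_arcs: "inj_on Q (out_arcs (dgraph \<Gamma>) x)"
proof (rule inj_onI)
  fix d e assume de: "d \<in> out_arcs (dgraph \<Gamma>) x" "e \<in> out_arcs (dgraph \<Gamma>) x" "Q d = Q e"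
  then obtain k where k: "actE k d = e" using Q_eq_iff by auto
  then have "actV k x = x"
    using act_hom[of k] de by (auto simp: wgraph_hom_def)
  then have "actE k = id" using free[of x k] de(1) by auto
  with k show "d = e" by simp
qed

text \<open>An element that moves the given end point of e to u moves e to an arc at u in the same
  orbit. The arcs at a vertex of the quotient can therefore be read off at any
  representative.\<close>

lemma Q_transport:
  assumes "e \<in> arcs (dgraph \<Gamma>)" "u \<in> verts (dgraph \<Gamma>)"
  shows "P (tail (dgraph \<Gamma>) e) = P u \<Longrightarrow> Q e \<in> Q ` out_arcs (dgraph \<Gamma>) u"
    and "P (head (dgraph \<Gamma>) e) = P u \<Longrightarrow> Q e \<in> Q ` in_arcs (dgraph \<Gamma>) u"
proof -
  have k: "actE k e \<in> arcs (dgraph \<Gamma>)" "Q e = Q (actE k e)"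
    "tail (dgraph \<Gamma>) (actE k e) = actV k (tail (dgraph \<Gamma>) e)"
    "head (dgraph \<Gamma>) (actE k e) = actV k (head (dgraph \<Gamma>) e)" for k
    using act_hom[of k] assms(1) Q_eq_iff by (auto simp: wgraph_hom_def)
  show "Q e \<in> Q ` out_arcs (dgraph \<Gamma>) u" if "P (tail (dgraph \<Gamma>) e) = P u"
    using that k assms P_eq_iff[of "tail (dgraph \<Gamma>) e" u] by (metis image_eqI in_out_arcs_conv tail_in_verts)
  show "Q e \<in> Q ` in_arcs (dgraph \<Gamma>) u" if "P (head (dgraph \<Gamma>) e) = P u"
    using that k assms P_eq_iff[of "head (dgraph \<Gamma>) e" u] by (metis image_eqI in_in_arcs_conv head_in_verts)
qed

text \<open>\<open>inv_into\<close> picks a representative arc of each orbit. Nothing depends on the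
  choice by \<open>Q_eq_imp\<close>, and \<open>quotient_arc_simps\<close> eliminates it.\<close>

definition quotient_graph :: "('a, 'b) wgraph" where
  "quotient_graph =
     \<lparr> dgraph =
         \<lparr> verts = P ` verts (dgraph \<Gamma>),
           arcs = Q ` arcs (dgraph \<Gamma>),
           tail = (\<lambda>d. P (tail (dgraph \<Gamma>) (inv_into (arcs (dgraph \<Gamma>)) Q d))),
           head = (\<lambda>d. P (head (dgraph \<Gamma>) (inv_into (arcs (dgraph \<Gamma>)) Q d))) \<rparr>,
       weight = (\<lambda>d. weight \<Gamma> (inv_into (arcs (dgraph \<Gamma>)) Q d)),
       base = P (base \<Gamma>) \<rparr>"

lemma quotient_simps [simp]:
  "verts (dgraph quotient_graph) = P ` verts (dgraph \<Gamma>)"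
  "arcs (dgraph quotient_graph) = Q ` arcs (dgraph \<Gamma>)"
  "base quotient_graph = P (base \<Gamma>)"
  by (simp_all add: quotient_graph_def)

lemma quotient_arc_simps [simp]:
  assumes "e \<in> arcs (dgraph \<Gamma>)"
  shows "tail (dgraph quotient_graph) (Q e) = P (tail (dgraph \<Gamma>) e)"
    and "head (dgraph quotient_graph) (Q e) = P (head (dgraph \<Gamma>) e)"
    and "weight quotient_graph (Q e) = weight \<Gamma> e"
proof -
  let ?e = "inv_into (arcs (dgraph \<Gamma>)) Q (Q e)"
  have "?e \<in> arcs (dgraph \<Gamma>)" "Q ?e = Q e"
    using assms by (auto intro: inv_into_into f_inv_into_f)
  from Q_eq_imp[OF this(1) assms this(2)]
  show "tail (dgraph quotient_graph) (Q e) = P (tail (dgraph \<Gamma>) e)"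
    and "head (dgraph quotient_graph) (Q e) = P (head (dgraph \<Gamma>) e)"
    and "weight quotient_graph (Q e) = weight \<Gamma> e"
    by (simp_all add: quotient_graph_def)
qed

lemma quotient_hom: "wgraph_hom \<Gamma> quotient_graph P Q"
  by (simp add: wgraph_hom_def)

lemma wf_quotient: "wf_digraph (dgraph quotient_graph)"
  by unfold_locales auto

lemma quotient_out_arcs:
  "x \<in> verts (dgraph \<Gamma>) \<Longrightarrow> out_arcs (dgraph quotient_graph) (P x) = Q ` out_arcs (dgraph \<Gamma>) x"
proof (intro equalityI subsetI)
  fix d assume x: "x \<in> verts (dgraph \<Gamma>)" and "d \<in> out_arcs (dgraph quotient_graph) (P x)"
  then obtain e where "e \<in> arcs (dgraph \<Gamma>)" "d = Q e" "P (tail (dgraph \<Gamma>) e) = P x"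
    by auto
  then show "d \<in> Q ` out_arcs (dgraph \<Gamma>) x"
    using x Q_transport(1) by simp
qed auto

lemma quotient_in_arcs:
  "x \<in> verts (dgraph \<Gamma>) \<Longrightarrow> in_arcs (dgraph quotient_graph) (P x) = Q ` in_arcs (dgraph \<Gamma>) x"
proof (intro equalityI subsetI)
  fix d assume x: "x \<in> verts (dgraph \<Gamma>)" and "d \<in> in_arcs (dgraph quotient_graph) (P x)"
  then obtain e where "e \<in> arcs (dgraph \<Gamma>)" "d = Q e" "P (head (dgraph \<Gamma>) e) = P x"
    by auto
  then show "d \<in> Q ` in_arcs (dgraph \<Gamma>) x"
    using x Q_transport(2) by simp
qed auto

text \<open>Fixing the weight singles out one pair of end points upstairs: with the tail fixed, the
  weight determines the weight of the head, and weight and orbit determine the head. Conversely, the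
  end points determine the weight of an arc. So a class of arcs in the quotient is counted by the
  arcs between two fixed vertices of \<Gamma>.\<close>

lemma quotient_arc_class:
  assumes e: "e \<in> arcs (dgraph \<Gamma>)"
  shows "{d \<in> arcs (dgraph quotient_graph). tail (dgraph quotient_graph) d = P (tail (dgraph \<Gamma>) e) \<and>
      head (dgraph quotient_graph) d = P (head (dgraph \<Gamma>) e) \<and> weight quotient_graph d = weight \<Gamma> e} =
    Q ` {d \<in> out_arcs (dgraph \<Gamma>) (tail (dgraph \<Gamma>) e). head (dgraph \<Gamma>) d = head (dgraph \<Gamma>) e}"
    (is "?L = Q ` ?R")
proof (intro equalityI subsetI)
  fix x assume x: "x \<in> ?L"
  then have "x \<in> out_arcs (dgraph quotient_graph) (P (tail (dgraph \<Gamma>) e))" by auto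
  then obtain d where d: "d \<in> arcs (dgraph \<Gamma>)" "tail (dgraph \<Gamma>) d = tail (dgraph \<Gamma>) e" "x = Q d"
    using quotient_out_arcs e by auto
  then have "vertex_weight \<Gamma> (head (dgraph \<Gamma>) d) = vertex_weight \<Gamma> (head (dgraph \<Gamma>) e)"
    using x e by (simp add: vertex_weight_head)
  then have "head (dgraph \<Gamma>) d = head (dgraph \<Gamma>) e"
    using x e d by (intro P_inj) auto
  with d show "x \<in> Q ` ?R" by auto
next
  fix x assume "x \<in> Q ` ?R"
  then obtain d where d: "d \<in> arcs (dgraph \<Gamma>)" "tail (dgraph \<Gamma>) d = tail (dgraph \<Gamma>) e"
    "head (dgraph \<Gamma>) d = head (dgraph \<Gamma>) e" "x = Q d"
    by auto
  have "vertex_weight \<Gamma> (tail (dgraph \<Gamma>) e) > 0"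
    using e vertex_weight_pos by simp
  then have "weight \<Gamma> d = weight \<Gamma> e"
    using vertex_weight_head[OF d(1)] vertex_weight_head[OF e] d(2,3) by simp
  with d show "x \<in> ?L" by auto
qed

text \<open>The reversal of \<open>\<Gamma>\<close> need not commute with the action, so it does not descend to the quotient;
  what descends is that opposite classes of arcs have the same size.\<close>

lemma quotient_reversal:
  obtains r where "\<And>d. d \<in> arcs (dgraph quotient_graph) \<Longrightarrow> r d \<in> arcs (dgraph quotient_graph) \<and> r (r d) = d \<and>
    tail (dgraph quotient_graph) (r d) = head (dgraph quotient_graph) d \<and>
    head (dgraph quotient_graph) (r d) = tail (dgraph quotient_graph) d \<and>
    weight quotient_graph d * weight quotient_graph (r d) = 1"
proof -
  obtain \<rho> where \<rho>: "\<And>e. e \<in> arcs (dgraph \<Gamma>) \<Longrightarrow> \<rho> e \<in> arcs (dgraph \<Gamma>)"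
    "\<And>e. e \<in> arcs (dgraph \<Gamma>) \<Longrightarrow> \<rho> (\<rho> e) = e"
    "\<And>e. e \<in> arcs (dgraph \<Gamma>) \<Longrightarrow> tail (dgraph \<Gamma>) (\<rho> e) = head (dgraph \<Gamma>) e"
    "\<And>e. e \<in> arcs (dgraph \<Gamma>) \<Longrightarrow> head (dgraph \<Gamma>) (\<rho> e) = tail (dgraph \<Gamma>) e"
    "\<And>e. e \<in> arcs (dgraph \<Gamma>) \<Longrightarrow> weight \<Gamma> (\<rho> e) = inverse (weight \<Gamma> e)"
    by (rule reversal) blast
  define c where "c d = (tail (dgraph quotient_graph) d, head (dgraph quotient_graph) d,
    weight quotient_graph d)" for d
  define \<sigma> :: "'a \<times> 'a \<times> real \<Rightarrow> 'a \<times> 'a \<times> real" where "\<sigma> = (\<lambda>(x, y, w). (y, x, inverse w))"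
  define R where "R e = {d \<in> out_arcs (dgraph \<Gamma>) (tail (dgraph \<Gamma>) e).
    head (dgraph \<Gamma>) d = head (dgraph \<Gamma>) e}" for e
  have cls: "{d \<in> arcs (dgraph quotient_graph). c d = c (Q e)} = Q ` R e" if "e \<in> arcs (dgraph \<Gamma>)" for e
    using quotient_arc_class[OF that] that by (simp add: c_def R_def)
  have c\<sigma>: "\<sigma> (c (Q e)) = c (Q (\<rho> e))" if "e \<in> arcs (dgraph \<Gamma>)" for e
    using that \<rho> by (simp add: c_def \<sigma>_def)
  have fin: "finite (R e)" if "e \<in> arcs (dgraph \<Gamma>)" for e
    by (rule finite_subset[OF _ finite_out_arcs[OF tail_in_verts[OF that]]]) (auto simp: R_def)
  have cardQ: "card (Q ` R e) = card (R e)" for e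
    by (rule card_image, rule inj_on_subset[OF Q_inj_out_arcs[of "tail (dgraph \<Gamma>) e"]]) (auto simp: R_def)
  \<comment> \<open>Only the effect of \<rho> on the arcs between two fixed vertices of \<Gamma>
    enters here: it exchanges the two directions bijectively.\<close>
  have card\<rho>: "card (R (\<rho> e)) = card (R e)" if e: "e \<in> arcs (dgraph \<Gamma>)" for e
    by (rule bij_betw_same_card[of \<rho>], rule bij_betwI[where g = \<rho>])
      (use e \<rho> in \<open>auto simp: R_def\<close>)
  have 1: "\<sigma> (\<sigma> (c d)) = c d" for d
    by (simp add: \<sigma>_def c_def)
  have 2: "finite {y \<in> arcs (dgraph quotient_graph). c y = c d}" if "d \<in> arcs (dgraph quotient_graph)" for d
    using that cls fin by auto
  have 3: "card {y \<in> arcs (dgraph quotient_graph). c y = \<sigma> (c d)} =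
      card {y \<in> arcs (dgraph quotient_graph). c y = c d}"
    if d: "d \<in> arcs (dgraph quotient_graph)" for d
  proof -
    obtain e where e: "e \<in> arcs (dgraph \<Gamma>)" "d = Q e" using d by auto
    show ?thesis
      unfolding e(2) c\<sigma>[OF e(1)] cls[OF e(1)] cls[OF \<rho>(1)[OF e(1)]] cardQ card\<rho>[OF e(1)] ..
  qed
  from involution_of_card_eq[of "arcs (dgraph quotient_graph)" \<sigma> c, OF 1 2 3]
  obtain r where r: "\<And>d. d \<in> arcs (dgraph quotient_graph) \<Longrightarrow> r d \<in> arcs (dgraph quotient_graph)"
    "\<And>d. d \<in> arcs (dgraph quotient_graph) \<Longrightarrow> r (r d) = d"
    "\<And>d. d \<in> arcs (dgraph quotient_graph) \<Longrightarrow> c (r d) = \<sigma> (c d)"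
    by blast
  have "weight quotient_graph d > 0" if "d \<in> arcs (dgraph quotient_graph)" for d
    using that weight_pos by auto
  then show thesis
    using r that[of r] by (force simp: c_def \<sigma>_def)
qed

lemma fair_balanced_quotient: "fair_balanced \<delta> quotient_graph"
proof -
  interpret L: wf_digraph "dgraph quotient_graph" by (rule wf_quotient)
  obtain r where r: "\<And>d. d \<in> arcs (dgraph quotient_graph) \<Longrightarrow> r d \<in> arcs (dgraph quotient_graph) \<and> r (r d) = d \<and>
    tail (dgraph quotient_graph) (r d) = head (dgraph quotient_graph) d \<and>
    head (dgraph quotient_graph) (r d) = tail (dgraph quotient_graph) d \<and>
    weight quotient_graph d * weight quotient_graph (r d) = 1"
    by (rule quotient_reversal) blast
  \<comment> \<open>With symmetry, reachability in the symmetrised graph, which defines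
    connectedness, reduces to reachability by directed paths, and these are projected from
    \<Gamma>.\<close>
  have "symmetric (dgraph quotient_graph)"
    unfolding symmetric_conv using r by metis
  moreover have "x \<rightarrow>\<^sup>*\<^bsub>dgraph quotient_graph\<^esub> y"
    if xy: "x \<in> verts (dgraph quotient_graph)" "y \<in> verts (dgraph quotient_graph)" for x y
  proof -
    obtain u v where uv: "u \<in> verts (dgraph \<Gamma>)" "v \<in> verts (dgraph \<Gamma>)" "x = P u" "y = P v"
      using xy by auto
    obtain p where "awalk u p v" using ex_awalk[OF uv(1,2)] .
    from wgraph_hom_awalk(1)[OF quotient_hom wf_digraph_axioms this] show ?thesis
      using uv L.reachable_awalk by auto
  qed
  ultimately have conn: "connected (dgraph quotient_graph)"
    using base_in_verts by (intro L.connectedI) (auto simp: L.reachable_mk_symmetric_eq)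
  have sum: "(\<Sum>e \<in> out_arcs (dgraph quotient_graph) (P x). weight quotient_graph e) = \<delta>"
    if x: "x \<in> verts (dgraph \<Gamma>)" for x
  proof -
    have "(\<Sum>e \<in> out_arcs (dgraph quotient_graph) (P x). weight quotient_graph e) =
        (\<Sum>e \<in> out_arcs (dgraph \<Gamma>) x. weight quotient_graph (Q e))"
      unfolding quotient_out_arcs[OF x] by (simp add: sum.reindex[OF Q_inj_out_arcs])
    also have "\<dots> = (\<Sum>e \<in> out_arcs (dgraph \<Gamma>) x. weight \<Gamma> e)"
      by (rule sum.cong) auto
    finally show ?thesis using out_weight_sum[OF x] by simp
  qed
  show ?thesis
    unfolding fair_balanced_def
  proof (intro conjI)
    show "\<exists>rev. \<forall>e \<in> arcs (dgraph quotient_graph).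
        rev e \<in> arcs (dgraph quotient_graph) \<and> rev (rev e) = e \<and>
        tail (dgraph quotient_graph) (rev e) = head (dgraph quotient_graph) e \<and>
        head (dgraph quotient_graph) (rev e) = tail (dgraph quotient_graph) e \<and>
        weight quotient_graph e * weight quotient_graph (rev e) = 1"
      using r by blast
    show "\<forall>x \<in> verts (dgraph quotient_graph). finite (out_arcs (dgraph quotient_graph) x) \<and>
        finite (in_arcs (dgraph quotient_graph) x)"
      by (auto simp: quotient_out_arcs quotient_in_arcs finite_out_arcs finite_in_arcs)
    show "\<forall>e \<in> arcs (dgraph quotient_graph). weight quotient_graph e > 0"
      using weight_pos by simp
    show "\<forall>x \<in> verts (dgraph quotient_graph).
        (\<Sum>e \<in> out_arcs (dgraph quotient_graph) x. weight quotient_graph e) = \<delta>"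
      using sum by simp
    show "base quotient_graph \<in> verts (dgraph quotient_graph)"
      using base_in_verts by simp
  qed (fact wf_quotient conn)+
qed

lemma quotient_cover_iso: "pointed_isomorphic (tracial_cover quotient_graph) \<Gamma>"
proof (rule covering_imp_cover_iso[OF wf_quotient quotient_hom])
  show "inj_on (\<lambda>v. (vertex_weight \<Gamma> v, P v)) (verts (dgraph \<Gamma>))"
    by (rule inj_onI) (simp add: P_inj)
qed (simp_all add: quotient_out_arcs Q_inj_out_arcs)

lemma act_weight_in_loop_weights:
  "vertex_weight \<Gamma> (actV k (base \<Gamma>)) \<in> loop_weights quotient_graph"
proof -
  have v: "actV k (base \<Gamma>) \<in> verts (dgraph \<Gamma>)"
    using act_hom base_in_verts by (auto simp: wgraph_hom_def)
  obtain p where p: "awalk (base \<Gamma>) p (actV k (base \<Gamma>))" using ex_awalk[OF base_in_verts v] .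
  have "P (actV k (base \<Gamma>)) = P (base \<Gamma>)"
    using P_eq_iff[OF base_in_verts v] by metis
  then show ?thesis
    using wgraph_hom_awalk[OF quotient_hom wf_digraph_axioms p] vertex_weight_eq[OF p]
    unfolding loop_weights_def by (auto intro!: exI[of _ "map Q p"])
qed

end


section \<open>Naming orbits, and the action of the integers\<close>

text \<open>The countably many orbits are numbered, and the numbers are embedded in the infinite
  type 'c; this places the quotient in any prescribed types.\<close>

lemma countable_orbit_map:
  fixes act :: "'g::group_add \<Rightarrow> 'x \<Rightarrow> 'x"
  assumes "countable A" and act0: "\<And>x. act 0 x = x"
    and act_add: "\<And>j k x. act (j + k) x = act j (act k x)"
  obtains P :: "'x \<Rightarrow> 'c::infinite"
  where "\<And>x y. x \<in> A \<Longrightarrow> y \<in> A \<Longrightarrow> P x = P y \<longleftrightarrow> (\<exists>k. act k x = y)"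
proof -
  define orb where "orb x = range (\<lambda>k. act k x)" for x
  have orb_eq: "orb x = orb y \<longleftrightarrow> (\<exists>k. act k x = y)" for x y
  proof
    assume "orb x = orb y"
    then have "y \<in> orb x" using act0 by (metis orb_def rangeI)
    then show "\<exists>k. act k x = y" by (auto simp: orb_def)
  next
    assume "\<exists>k. act k x = y"
    then obtain k where k: "act k x = y" by blast
    then have "act (- k) y = x" using act_add[of "- k" k x] act0 by simp
    have sub: "orb (act m z) \<subseteq> orb z" for m z
      by (auto simp: orb_def simp flip: act_add)
    show "orb x = orb y"
      using sub[of k x] sub[of "- k" y] k \<open>act (- k) y = x\<close> by auto
  qed
  obtain h :: "nat \<Rightarrow> 'c" where h: "inj h"
    using infinite_countable_subset[of "UNIV :: 'c set"] infinite_UNIV by auto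
  have "countable (orb ` A)" using assms(1) by simp
  then obtain i :: "'x set \<Rightarrow> nat" where i: "inj_on i (orb ` A)"
    by (rule countableE)
  have "h (i (orb x)) = h (i (orb y)) \<longleftrightarrow> (\<exists>k. act k x = y)" if "x \<in> A" "y \<in> A" for x y
  proof -
    have "h (i (orb x)) = h (i (orb y)) \<longleftrightarrow> i (orb x) = i (orb y)"
      using h by (rule inj_eq)
    also have "\<dots> \<longleftrightarrow> orb x = orb y"
      using that by (intro inj_on_eq_iff[OF i] imageI)
    also note orb_eq
    finally show ?thesis .
  qed
  then show thesis using that[of "\<lambda>x. h (i (orb x))"] by blast
qed

text \<open>Negative powers use \<open>inv\<close>, the inverse on the whole type, so the power laws
  call for a bijection of the type and not just of the carrier.\<close>

definition funpow_int :: "('x \<Rightarrow> 'x) \<Rightarrow> int \<Rightarrow> 'x \<Rightarrow> 'x" where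
  "funpow_int f k = (if k \<ge> 0 then f ^^ nat k else inv f ^^ nat (- k))"

lemma funpow_int_0: "funpow_int f 0 x = x"
  and funpow_int_1: "funpow_int f 1 x = f x"
  by (simp_all add: funpow_int_def)

lemma funpow_int_add_1:
  assumes "bij f"
  shows "funpow_int f (k + 1) x = f (funpow_int f k x)"
proof (cases "k \<ge> 0")
  case True
  then show ?thesis by (simp add: funpow_int_def nat_add_distrib)
next
  case False
  \<comment> \<open>With this n, \<open>funpow_int f k\<close> applies \<open>inv f\<close> exactly
    Suc n times, and one application of f cancels one of them. For k = -1 this leaves n = 0, where k
    + 1 falls under the nonnegative branch.\<close>
  define n where "n = nat (- (k + 1))"
  have "nat (- k) = Suc n" "k + 1 = - int n" using False by (simp_all add: n_def)
  moreover have "f (inv f y) = y" for y using assms by (simp add: bij_is_surj surj_f_inv_f)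
  ultimately show ?thesis using False by (auto simp: funpow_int_def)
qed

lemma funpow_int_add:
  assumes "bij f"
  shows "funpow_int f (j + k) x = funpow_int f j (funpow_int f k x)"
proof (induction j rule: int_induct[where k = 0])
  case base
  show ?case by (simp add: funpow_int_0)
next
  case (step1 j)
  then show ?case
    using funpow_int_add_1[OF assms, of "j + k"] funpow_int_add_1[OF assms, of j]
    by (simp add: add.commute add.left_commute)
next
  case (step2 j)
  \<comment> \<open>The downward step is proved after applying f to both sides, which returns to j;
    injectivity of f then cancels it.\<close>
  have "f (funpow_int f (j - 1 + k) x) = f (funpow_int f (j - 1) (funpow_int f k x))"
    using step2 funpow_int_add_1[OF assms, of "j - 1 + k"] funpow_int_add_1[OF assms, of "j - 1"]
    by (simp add: algebra_simps)
  then show ?case using assms by (simp add: bij_is_inj inj_eq)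
qed

text \<open>An automorphism is controlled only on vertices and arcs. Continuing it by the identity
  gives a bijection of the type, to which \<open>funpow_int\<close> applies.\<close>

lemma bij_extend:
  assumes "bij_betw f A A"
  shows "bij (\<lambda>x. if x \<in> A then f x else x)" (is "bij ?F")
proof -
  have "bij_betw ?F A A" using assms by (simp cong: bij_betw_cong)
  moreover have "bij_betw ?F (- A) (- A)"
    by (rule bij_betw_cong[THEN iffD1, OF _ bij_betw_id]) auto
  ultimately have "bij_betw ?F (A \<union> - A) (A \<union> - A)" by (rule bij_betw_combine) auto
  then show ?thesis by simp
qed

lemma wgraph_hom_funpow:
  assumes "wgraph_hom A A f g" "wf_digraph (dgraph A)"
  shows "wgraph_hom A A (f ^^ n) (g ^^ n)"
  using assms by (induction n) (auto simp: wgraph_hom_def)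

lemma wgraph_hom_inv:
  assumes iso: "wgraph_iso A A f g" and "bij f" "bij g" "wf_digraph (dgraph A)"
  shows "wgraph_hom A A (inv f) (inv g)"
proof -
  have f: "inv f (f v) = v" and g: "inv g (g e) = e" for v e
    using assms by (simp_all add: bij_is_inj)
  have "inv f v \<in> verts (dgraph A)" if v: "v \<in> verts (dgraph A)" for v
  proof -
    have "v \<in> f ` verts (dgraph A)"
      using iso v by (simp add: wgraph_iso_def bij_betw_def)
    then show ?thesis using f by auto
  qed
  moreover have "inv g e \<in> arcs (dgraph A) \<and>
      tail (dgraph A) (inv g e) = inv f (tail (dgraph A) e) \<and>
      head (dgraph A) (inv g e) = inv f (head (dgraph A) e) \<and> weight A (inv g e) = weight A e"
    if e: "e \<in> arcs (dgraph A)" for e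
  proof -
    have "e \<in> g ` arcs (dgraph A)"
      using iso e by (simp add: wgraph_iso_def bij_betw_def)
    then obtain d where "d \<in> arcs (dgraph A)" "e = g d" by blast
    then show ?thesis using f g iso by (simp add: wgraph_iso_def wgraph_hom_def)
  qed
  ultimately show ?thesis by (simp add: wgraph_hom_def)
qed

section \<open>From automorphisms to loops\<close>

context tracial_graph
begin

text \<open>The action is left general so that both the trivial action, whose quotient is a copy of
  \<Gamma> in the types 'a and 'b, and the powers of an automorphism are instances.\<close>

lemma act_weight_in_T0:
  fixes actV :: "'g::group_add \<Rightarrow> 'v \<Rightarrow> 'v" and actE :: "'g \<Rightarrow> 'e \<Rightarrow> 'e"
  assumes act_hom: "\<And>k. wgraph_hom \<Gamma> \<Gamma> (actV k) (actE k)"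
    and free: "\<And>k v. v \<in> verts (dgraph \<Gamma>) \<Longrightarrow> vertex_weight \<Gamma> (actV k v) = vertex_weight \<Gamma> v \<Longrightarrow>
      actV k = id \<and> actE k = id"
    and act0: "\<And>v. actV 0 v = v" "\<And>e. actE 0 e = e"
    and act_add: "\<And>j k v. actV (j + k) v = actV j (actV k v)"
      "\<And>j k e. actE (j + k) e = actE j (actE k e)"
  shows "vertex_weight \<Gamma> (actV k (base \<Gamma>)) \<in> T0 TYPE('a::infinite) TYPE('b::infinite) \<delta> \<Gamma>"
proof -
  obtain P :: "'v \<Rightarrow> 'a" where P: "\<And>u v. u \<in> verts (dgraph \<Gamma>) \<Longrightarrow> v \<in> verts (dgraph \<Gamma>) \<Longrightarrow>
      P u = P v \<longleftrightarrow> (\<exists>k. actV k u = v)"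
    by (rule countable_orbit_map[where act = actV, OF countable_verts act0(1) act_add(1)]) blast
  obtain Q :: "'e \<Rightarrow> 'b" where Q: "\<And>d e. d \<in> arcs (dgraph \<Gamma>) \<Longrightarrow> e \<in> arcs (dgraph \<Gamma>) \<Longrightarrow>
      Q d = Q e \<longleftrightarrow> (\<exists>k. actE k d = e)"
    by (rule countable_orbit_map[where act = actE, OF countable_arcs act0(2) act_add(2)]) blast
  interpret weight_free_quotient \<delta> \<Gamma> actV actE P Q
    by unfold_locales (fact act_hom free P Q)+
  have "vertex_weight \<Gamma> (actV k (base \<Gamma>)) > 0"
    using act_hom base_in_verts by (intro vertex_weight_pos) (simp add: wgraph_hom_def)
  then show ?thesis
    unfolding T0_def
    using fair_balanced_quotient quotient_cover_iso act_weight_in_loop_weights by blast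
qed

lemma W_times_subset_T0:
  "W_times \<Gamma> \<subseteq> T0 TYPE('a::infinite) TYPE('b::infinite) \<delta> \<Gamma>"
proof
  fix r assume "r \<in> W_times \<Gamma>"
  then obtain \<alpha> where \<alpha>: "weighted_isomorphism \<Gamma> \<Gamma> \<alpha>"
    and r: "r = vertex_weight \<Gamma> (iso_verts \<alpha> (base \<Gamma>))"
    unfolding W_times_def Aut_def by blast
  show "r \<in> T0 TYPE('a) TYPE('b) \<delta> \<Gamma>"
  proof (cases "r = 1")
    case True
    \<comment> \<open>Powers of \<alpha> may violate \<open>free\<close> here, so \<alpha> is
      replaced by the trivial action; the weight 1 arises from its base vertex.\<close>
    have "vertex_weight \<Gamma> ((\<lambda>_::int. id) 0 (base \<Gamma>)) \<in> T0 TYPE('a) TYPE('b) \<delta> \<Gamma>"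
      by (rule act_weight_in_T0[where actE = "\<lambda>_::int. id"]) (auto simp: wgraph_hom_def)
    then show ?thesis using True vertex_weight_base by simp
  next
    case False
    define f where "f v = (if v \<in> verts (dgraph \<Gamma>) then iso_verts \<alpha> v else v)" for v
    define g where "g e = (if e \<in> arcs (dgraph \<Gamma>) then iso_arcs \<alpha> e else e)" for e
    have \<alpha>_iso: "wgraph_iso \<Gamma> \<Gamma> (iso_verts \<alpha>) (iso_arcs \<alpha>)"
      using \<alpha> by (rule weighted_isomorphism_imp_wgraph_iso)
    then have iso: "wgraph_iso \<Gamma> \<Gamma> f g"
      by (simp add: wgraph_iso_def wgraph_hom_def f_def g_def cong: bij_betw_cong)
    have "bij f" "bij g"
      unfolding f_def g_def using \<alpha>_iso by (auto intro!: bij_extend simp: wgraph_iso_def)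
    note bij = this
    let ?V = "funpow_int f" and ?E = "funpow_int g"
    have hom: "wgraph_hom \<Gamma> \<Gamma> (?V k) (?E k)" for k
      using wgraph_hom_funpow[OF _ wf_digraph_axioms] wgraph_hom_inv[OF iso bij wf_digraph_axioms] iso
      by (simp add: funpow_int_def wgraph_iso_def)
    \<comment> \<open>The scaling factor of the k-th power: a homomorphism from the integers to the
      positive reals. It is injective because c 1 = r \<noteq> 1 and 1 is the only positive real
      with a nontrivial power equal to 1; this yields \<open>free\<close>.\<close>
    define c where "c k = vertex_weight \<Gamma> (?V k (base \<Gamma>))" for k
    have c_pos: "c k > 0" for k
      unfolding c_def using hom base_in_verts by (intro vertex_weight_pos) (simp add: wgraph_hom_def)
    have c_add: "c (j + k) = c j * c k" for j k
      unfolding c_def funpow_int_add[OF bij(1)]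
      using hom[of k] base_in_verts by (intro vertex_weight_hom[OF hom]) (simp add: wgraph_hom_def)
    have c0: "c 0 = 1" by (simp add: c_def funpow_int_0 vertex_weight_base)
    have c1: "c 1 = r" by (simp add: c_def funpow_int_1 r f_def base_in_verts)
    have c_nat: "c (int n) = r ^ n" for n
      by (induction n) (simp_all add: c0 c1 c_add)
    have c_nat_eq_1: "n = 0" if "c (int n) = 1" for n
      using that False c_pos[of 1] c_nat power_eq_1_iff[of r n] by (auto simp: c1)
    have c_eq_1: "k = 0" if "c k = 1" for k
    proof (cases "k \<ge> 0")
      case True
      then show ?thesis using that c_nat_eq_1[of "nat k"] by simp
    next
      case neg: False
      have "c (- k) = 1" using that c_add[of k "- k"] c0 by simp
      then show ?thesis using neg c_nat_eq_1[of "nat (- k)"] by simp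
    qed
    have "vertex_weight \<Gamma> (?V 1 (base \<Gamma>)) \<in> T0 TYPE('a) TYPE('b) \<delta> \<Gamma>"
    proof (rule act_weight_in_T0[where actE = ?E])
      fix k v assume v: "v \<in> verts (dgraph \<Gamma>)"
        and "vertex_weight \<Gamma> (?V k v) = vertex_weight \<Gamma> v"
      then have "c k = 1"
        using vertex_weight_hom[OF hom v] vertex_weight_pos[OF v] by (simp add: c_def)
      then have "k = 0" by (rule c_eq_1)
      then show "?V k = id \<and> ?E k = id" by (auto simp: funpow_int_0)
    qed (simp_all add: hom funpow_int_0 funpow_int_add bij)
    then show ?thesis using c1 by (simp add: c_def)
  qed
qed

end

theorem theorem1p2:
  fixes \<Gamma> :: "('v, 'e) wgraph" and \<delta> :: real
  assumes "fair_balanced \<delta> \<Gamma>" and "tracial \<Gamma>"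
  shows "T0 TYPE('a::infinite) TYPE('b::infinite) \<delta> \<Gamma> = W_times \<Gamma>"
proof -
  interpret tracial_graph \<delta> \<Gamma>
    by unfold_locales (fact assms)+
  show ?thesis
    using W_times_subset_T0 loop_weight_in_W_times by (auto simp: T0_def)
qed

end
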